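(* Let $M=\mathscr{I}^{\nearrow}_{\infty}(\mathbb{Z})$ be the monoid of all injective monotone partial selfmaps of $\mathbb{Z}$ with cofinite domain and cofinite range. Then: (i) An element $\alpha\in M$ is an idempotent if and only if $(x)\alpha=x$ for every $x\in\operatorname{dom}\alpha$. (ii) If $\varepsilon,\iota\in E(M)$, then $\varepsilon\leqslant\iota$ if and only if $\operatorname{dom}\varepsilon\subseteq\operatorname{dom}\iota$. (iii) The semilattice $E(M)$ is isomorphic to the semilattice $(\mathscr{P}_{<\omega}(\mathbb{Z}),\subseteq)$ of all finite subsets of $\mathbb{Z}$ with the operation of union, under the mapping $(\varepsilon)h=\mathbb{Z}\setminus\operatorname{dom}\varepsilon$. (iv) Every maximal chain in $E(M)$ is an $\omega$-chain. (v) $\alpha\mathscr{R}\beta$ in $M$ if and only if $\operatorname{dom}\alpha=\operatorname{dom}\beta$. (vi) $\alpha\mathscr{L}\beta$ in $M$ if and only if $\operatorname{ran}\alpha=\operatorname{ran}\beta$. (vii) $\alpha\mathscr{H}\beta$ in $M$ if and only if $\operatorname{dom}\alpha=\operatorname{dom}\beta$ and $\operatorname{ran}\alpha=\operatorname{ran}\beta$. (viii) $M$ is a simple semigroup and hence $\mathscr{J}=M\times M$. (ix) For all idempotents $\varepsilon,\varphi\in M$ there exist infinitely many elements $\alpha,\beta\in M$ such that $\alpha\cdot\beta=\varepsilon$ and $\beta\cdot\alpha=\varphi$.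
   Context: A partial map $\alpha\colon\mathbb{Z}\rightharpoonup\mathbb{Z}$ is monotone if $n\leqslant m$ implies $(n)\alpha\leqslant(m)\alpha$ for $n,m\in\operatorname{dom}\alpha$. $\mathscr{I}^{\nearrow}_{\infty}(\mathbb{Z})$ is the set of all injective monotone partial maps $\alpha\colon\mathbb{Z}\rightharpoonup\mathbb{Z}$ with $|\mathbb{Z}\setminus\operatorname{dom}\alpha|<\infty$ and $|\mathbb{Z}\setminus\operatorname{ran}\alpha|<\infty$, with composition $x(\alpha\beta)=(x\alpha)\beta$ for $x\in\operatorname{dom}(\alpha\beta)=\{y\in\operatorname{dom}\alpha\mid y\alpha\in\operatorname{dom}\beta\}$ (maps are written on the right). It is an inverse monoid. For an inverse semigroup $S$, $E(S)$ is the set of idempotents, with the natural partial order $e\leqslant f$ iff $ef=fe=e$; it is a semilattice (commutative semigroup of idempotents). A chain in a semilattice is a linearly ordered subset; a maximal chain is one properly contained in no other chain; an $\omega$-chain is a chain order-isomorphic to $\{0,-1,-2,-3,\ldots\}$ with the usual order. Green's relations on $S$: $a\mathscr{R}b$ iff $aS^1=bS^1$; $a\mathscr{L}b$ iff $S^1a=S^1b$; $a\mathscr{J}b$ iff $S^1aS^1=S^1bS^1$; $\mathscr{H}=\mathscr{L}\cap\mathscr{R}$. A semigroup is simple if it has no proper two-sided ideals. *)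

theory Defs
  imports "HOL-Algebra.Group"
begin

text \<open>
  A semigroup is given by the \<open>carrier\<close> and \<open>mult\<close> fields of a \<open>monoid\<close> record; apart from
  the monoid \<open>IZ\<close> of partial maps, the \<open>one\<close> field plays no role below.
\<close>

definition idempotents :: "('a, 'b) monoid_scheme \<Rightarrow> 'a set" where
  "idempotents S = {e \<in> carrier S. e \<otimes>\<^bsub>S\<^esub> e = e}"

definition nat_le :: "('a, 'b) monoid_scheme \<Rightarrow> 'a \<Rightarrow> 'a \<Rightarrow> bool" where
  "nat_le S e f \<longleftrightarrow> e \<otimes>\<^bsub>S\<^esub> f = e \<and> f \<otimes>\<^bsub>S\<^esub> e = e"

definition semilattice_struct :: "('a, 'b) monoid_scheme \<Rightarrow> bool" where
  "semilattice_struct S \<longleftrightarrow>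
     (\<forall>x\<in>carrier S. \<forall>y\<in>carrier S. x \<otimes>\<^bsub>S\<^esub> y \<in> carrier S) \<and>
     (\<forall>x\<in>carrier S. \<forall>y\<in>carrier S. \<forall>z\<in>carrier S.
        (x \<otimes>\<^bsub>S\<^esub> y) \<otimes>\<^bsub>S\<^esub> z = x \<otimes>\<^bsub>S\<^esub> (y \<otimes>\<^bsub>S\<^esub> z)) \<and>
     (\<forall>x\<in>carrier S. \<forall>y\<in>carrier S. x \<otimes>\<^bsub>S\<^esub> y = y \<otimes>\<^bsub>S\<^esub> x) \<and>
     (\<forall>x\<in>carrier S. x \<otimes>\<^bsub>S\<^esub> x = x)"

definition idempotent_part :: "('a, 'b) monoid_scheme \<Rightarrow> ('a, 'b) monoid_scheme" where
  "idempotent_part S = S\<lparr>carrier := idempotents S\<rparr>"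

text \<open>
  The principal ideals \<open>aS\<^sup>1\<close>, \<open>S\<^sup>1a\<close> and \<open>S\<^sup>1aS\<^sup>1\<close>; the contribution of the identity of \<open>S\<^sup>1\<close> is
  written out explicitly, so no identity needs to be adjoined to \<open>S\<close>.
\<close>

definition right_principal :: "('a, 'b) monoid_scheme \<Rightarrow> 'a \<Rightarrow> 'a set" where
  "right_principal S a = {a} \<union> {a \<otimes>\<^bsub>S\<^esub> s | s. s \<in> carrier S}"

definition left_principal :: "('a, 'b) monoid_scheme \<Rightarrow> 'a \<Rightarrow> 'a set" where
  "left_principal S a = {a} \<union> {s \<otimes>\<^bsub>S\<^esub> a | s. s \<in> carrier S}"

definition two_sided_principal :: "('a, 'b) monoid_scheme \<Rightarrow> 'a \<Rightarrow> 'a set" where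
  "two_sided_principal S a =
     {a} \<union> {a \<otimes>\<^bsub>S\<^esub> t | t. t \<in> carrier S} \<union> {s \<otimes>\<^bsub>S\<^esub> a | s. s \<in> carrier S} \<union>
     {s \<otimes>\<^bsub>S\<^esub> a \<otimes>\<^bsub>S\<^esub> t | s t. s \<in> carrier S \<and> t \<in> carrier S}"

definition green_R :: "('a, 'b) monoid_scheme \<Rightarrow> ('a \<times> 'a) set" where
  "green_R S = {(a, b). a \<in> carrier S \<and> b \<in> carrier S \<and>
                        right_principal S a = right_principal S b}"

definition green_L :: "('a, 'b) monoid_scheme \<Rightarrow> ('a \<times> 'a) set" where
  "green_L S = {(a, b). a \<in> carrier S \<and> b \<in> carrier S \<and>
                        left_principal S a = left_principal S b}"

definition green_J :: "('a, 'b) monoid_scheme \<Rightarrow> ('a \<times> 'a) set" where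
  "green_J S = {(a, b). a \<in> carrier S \<and> b \<in> carrier S \<and>
                        two_sided_principal S a = two_sided_principal S b}"

definition green_H :: "('a, 'b) monoid_scheme \<Rightarrow> ('a \<times> 'a) set" where
  "green_H S = green_L S \<inter> green_R S"

text \<open>Ideals are nonempty, as usual in semigroup theory.\<close>

definition two_sided_ideal :: "('a, 'b) monoid_scheme \<Rightarrow> 'a set \<Rightarrow> bool" where
  "two_sided_ideal S I \<longleftrightarrow> I \<noteq> {} \<and> I \<subseteq> carrier S \<and>
     (\<forall>a\<in>I. \<forall>s\<in>carrier S. s \<otimes>\<^bsub>S\<^esub> a \<in> I \<and> a \<otimes>\<^bsub>S\<^esub> s \<in> I)"

definition simple_semigroup :: "('a, 'b) monoid_scheme \<Rightarrow> bool" where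
  "simple_semigroup S \<longleftrightarrow> \<not> (\<exists>I. two_sided_ideal S I \<and> I \<noteq> carrier S)"

definition idempotent_chain :: "('a, 'b) monoid_scheme \<Rightarrow> 'a set \<Rightarrow> bool" where
  "idempotent_chain S = pred_on.chain (idempotents S) (nat_le S)"

definition maximal_idempotent_chain :: "('a, 'b) monoid_scheme \<Rightarrow> 'a set \<Rightarrow> bool" where
  "maximal_idempotent_chain S = pred_on.maxchain (idempotents S) (nat_le S)"

definition omega_idempotent_chain :: "('a, 'b) monoid_scheme \<Rightarrow> 'a set \<Rightarrow> bool" where
  "omega_idempotent_chain S C \<longleftrightarrow> idempotent_chain S C \<and>
     (\<exists>f :: 'a \<Rightarrow> int. bij_betw f C {..0} \<and> (\<forall>x\<in>C. \<forall>y\<in>C. nat_le S x y \<longleftrightarrow> f x \<le> f y))"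

definition monotone_pmap :: "(int \<rightharpoonup> int) \<Rightarrow> bool" where
  "monotone_pmap \<alpha> \<longleftrightarrow> (\<forall>n\<in>dom \<alpha>. \<forall>m\<in>dom \<alpha>. n \<le> m \<longrightarrow> the (\<alpha> n) \<le> the (\<alpha> m))"

text \<open>
  Maps act on the right, so the product \<open>\<alpha>\<beta>\<close> applies \<open>\<alpha>\<close> first: it is \<open>\<beta> \<circ>\<^sub>m \<alpha>\<close>.
\<close>

definition IZ :: "(int \<rightharpoonup> int) monoid" where
  "IZ = \<lparr>carrier = {\<alpha>. inj_on \<alpha> (dom \<alpha>) \<and> monotone_pmap \<alpha> \<and>
                      finite (UNIV - dom \<alpha>) \<and> finite (UNIV - ran \<alpha>)},
         mult = (\<lambda>\<alpha> \<beta>. \<beta> \<circ>\<^sub>m \<alpha>),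
         one = Some\<rparr>"

definition finite_subsets_union :: "int set monoid" where
  "finite_subsets_union = \<lparr>carrier = {A. finite A}, mult = (\<union>), one = {}\<rparr>"

lemma IZ_mult_closed:
  assumes a: "\<alpha> \<in> carrier IZ" and b: "\<beta> \<in> carrier IZ"
  shows "\<alpha> \<otimes>\<^bsub>IZ\<^esub> \<beta> \<in> carrier IZ"
proof -
  let ?g = "\<beta> \<circ>\<^sub>m \<alpha>"
  have ia: "x = y" if "\<alpha> x = Some z" "\<alpha> y = Some z" for x y z
    using a that by (auto simp: IZ_def inj_on_def dom_def)
  have ib: "x = y" if "\<beta> x = Some z" "\<beta> y = Some z" for x y z
    using b that by (auto simp: IZ_def inj_on_def dom_def)
  have ma: "u \<le> v" if "\<alpha> x = Some u" "\<alpha> y = Some v" "x \<le> y" for x y u v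
    using a that by (force simp: IZ_def monotone_pmap_def dom_def)
  have mb: "u \<le> v" if "\<beta> x = Some u" "\<beta> y = Some v" "x \<le> y" for x y u v
    using b that by (force simp: IZ_def monotone_pmap_def dom_def)
  have inj: "inj_on ?g (dom ?g)"
  proof (rule inj_onI)
    fix x y assume "x \<in> dom ?g" "y \<in> dom ?g" "?g x = ?g y"
    then obtain z where "?g x = Some z" "?g y = Some z" by auto
    then show "x = y" by (auto simp: map_comp_Some_iff dest: ib ia)
  qed
  have mono: "monotone_pmap ?g"
    unfolding monotone_pmap_def
  proof (intro ballI impI)
    fix n m assume "n \<in> dom ?g" "m \<in> dom ?g" and le: "n \<le> m"
    then obtain u v where "?g n = Some u" "?g m = Some v" by blast
    then show "the (?g n) \<le> the (?g m)"
      using le by (auto simp: map_comp_Some_iff intro: mb ma)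
  qed
  have "UNIV - dom ?g \<subseteq> (UNIV - dom \<alpha>) \<union> (\<lambda>z. THE x. \<alpha> x = Some z) ` (UNIV - dom \<beta>)"
  proof
    fix x assume x: "x \<in> UNIV - dom ?g"
    show "x \<in> (UNIV - dom \<alpha>) \<union> (\<lambda>z. THE x. \<alpha> x = Some z) ` (UNIV - dom \<beta>)"
    proof (cases "\<alpha> x")
      case (Some z)
      then have "z \<in> UNIV - dom \<beta>" using x by (auto simp: map_comp_def)
      moreover have "(THE x. \<alpha> x = Some z) = x" using Some ia by blast
      ultimately show ?thesis by (metis UnI2 image_eqI)
    qed auto
  qed
  then have fd: "finite (UNIV - dom ?g)"
    by (rule finite_subset) (use a b in \<open>auto simp: IZ_def\<close>)
  have "UNIV - ran ?g \<subseteq> (UNIV - ran \<beta>) \<union> (the \<circ> \<beta>) ` (UNIV - ran \<alpha>)"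
  proof
    fix z assume z: "z \<in> UNIV - ran ?g"
    show "z \<in> (UNIV - ran \<beta>) \<union> (the \<circ> \<beta>) ` (UNIV - ran \<alpha>)"
    proof (cases "z \<in> ran \<beta>")
      case True
      then obtain y where y: "\<beta> y = Some z" by (auto simp: ran_def)
      then have "y \<notin> ran \<alpha>" using z by (auto simp: ran_def map_comp_Some_iff)
      then show ?thesis using y by force
    qed auto
  qed
  then have fr: "finite (UNIV - ran ?g)"
    by (rule finite_subset) (use a b in \<open>auto simp: IZ_def\<close>)
  show ?thesis using inj mono fd fr by (simp add: IZ_def)
qed

lemma monoid_IZ: "monoid IZ"
proof
  show "\<one>\<^bsub>IZ\<^esub> \<in> carrier IZ"
    by (simp add: IZ_def monotone_pmap_def dom_def ran_def)
  fix x y z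
  show "x \<otimes>\<^bsub>IZ\<^esub> y \<otimes>\<^bsub>IZ\<^esub> z = x \<otimes>\<^bsub>IZ\<^esub> (y \<otimes>\<^bsub>IZ\<^esub> z)"
    by (auto simp: IZ_def map_comp_def split: option.splits)
  show "\<one>\<^bsub>IZ\<^esub> \<otimes>\<^bsub>IZ\<^esub> x = x" "x \<otimes>\<^bsub>IZ\<^esub> \<one>\<^bsub>IZ\<^esub> = x"
    by (auto simp: IZ_def map_comp_def split: option.splits)
qed (rule IZ_mult_closed)

end

theory Submission
  imports Defs
begin

text \<open>
  Everything rests on two facts: every \<open>\<alpha>\<close> in \<open>IZ\<close> has an inverse partial map in \<open>IZ\<close>, and any two
  cofinite subsets of the integers are the domain and the range of elements of \<open>IZ\<close>. The second is
  obtained by closing the gaps of a cofinite set one at a time, and infinitely many such elements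
  arise by translating in between. Finally, in a maximal chain of finite subsets of
  an infinite type every cardinality occurs exactly once, which gives the order type of (iv).
\<close>

section \<open>Maximal chains of finite sets\<close>

text \<open>Comparable finite sets of equal cardinality coincide, which gives injectivity. For
  surjectivity, a member with n elements is enlarged by one point so that it stays comparable with
  all of \<open>C\<close>; maximality then puts the enlarged set into \<open>C\<close>.\<close>

lemma card_bij_betw_maximal_chain:
  fixes C :: "'a set set"
  assumes inf: "infinite (UNIV :: 'a set)"
    and fin: "\<And>X. X \<in> C \<Longrightarrow> finite X"
    and chain: "\<And>X Y. X \<in> C \<Longrightarrow> Y \<in> C \<Longrightarrow> X \<subseteq> Y \<or> Y \<subseteq> X"
    and maxim: "\<And>X. finite X \<Longrightarrow> (\<And>Y. Y \<in> C \<Longrightarrow> X \<subseteq> Y \<or> Y \<subseteq> X) \<Longrightarrow> X \<in> C"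
  shows "bij_betw card C UNIV"
proof -
  have le: "X \<subseteq> Y" if "X \<in> C" "Y \<in> C" "card X \<le> card Y" for X Y
    using chain[OF that(1,2)] card_seteq[of X Y] fin that by blast
  have "\<exists>X\<in>C. card X = n" for n
  proof (induction n)
    case 0
    have "{} \<in> C" by (rule maxim) auto
    then show ?case by force
  next
    case (Suc n)
    then obtain A where A: "A \<in> C" "card A = n" by blast
    \<comment> \<open>The point to be added must lie in every member with more than n elements. A
      member \<open>B\<close> of least cardinality among these is contained in all of them, so any
      point of \<open>B\<close> outside \<open>A\<close> will do. If there are none, any point
      outside \<open>A\<close> serves, and one exists because the type is infinite.\<close>
    obtain x where x: "x \<notin> A" "\<And>Y. Y \<in> C \<Longrightarrow> card Y > n \<Longrightarrow> x \<in> Y"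
    proof (cases "\<exists>Y\<in>C. card Y > n")
      case True
      then obtain B where "is_arg_min card (\<lambda>Y. Y \<in> C \<and> card Y > n) B"
        using ex_has_least_nat[of "\<lambda>Y. Y \<in> C \<and> card Y > n" _ card]
        unfolding is_arg_min_linorder by blast
      then have B: "B \<in> C" "card B > n"
        "\<And>Y. Y \<in> C \<Longrightarrow> card Y > n \<Longrightarrow> card B \<le> card Y"
        unfolding is_arg_min_linorder by blast+
      have "\<not> B \<subseteq> A" using card_mono[OF fin[OF A(1)], of B] A(2) B(2) by linarith
      then obtain x where "x \<in> B" "x \<notin> A" by blast
      then show ?thesis using that B le by blast
    next
      case False
      then show ?thesis using that ex_new_if_finite[OF inf fin[OF A(1)]] by blast
    qed
    have "insert x A \<in> C"
    proof (rule maxim)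
      fix Y assume Y: "Y \<in> C"
      \<comment> \<open>A member with at most n elements is contained in \<open>A\<close>; a larger
        one contains both \<open>A\<close> and x.\<close>
      show "insert x A \<subseteq> Y \<or> Y \<subseteq> insert x A"
        using le[OF Y A(1)] le[OF A(1) Y] x(2)[OF Y] A(2)
        by (cases "card Y \<le> n") auto
    qed (use fin A in auto)
    moreover have "card (insert x A) = Suc n" using A fin x by simp
    ultimately show ?case by blast
  qed
  moreover have "inj_on card C"
    by (rule inj_onI) (use le in \<open>metis order_refl subset_antisym\<close>)
  ultimately show ?thesis by (auto simp: bij_betw_def) (metis imageI)
qed

section \<open>Inverses and existence of partial maps\<close>

text \<open>On a linear order, injective and monotone together amount to strictly increasing.
  Phrased through values \<open>Some u\<close>, this single condition is easy to check for concrete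
  maps and for inverses.\<close>

lemma IZ_iff:
  "\<alpha> \<in> carrier IZ \<longleftrightarrow>
     (\<forall>x y u v. \<alpha> x = Some u \<longrightarrow> \<alpha> y = Some v \<longrightarrow> x < y \<longrightarrow> u < v) \<and>
     finite (UNIV - dom \<alpha>) \<and> finite (UNIV - ran \<alpha>)" (is "?L \<longleftrightarrow> ?M \<and> ?F")
proof
  assume L: ?L
  have "u < v" if "\<alpha> x = Some u" "\<alpha> y = Some v" "x < y" for x y u v
  proof -
    have dom: "x \<in> dom \<alpha>" "y \<in> dom \<alpha>" using that by auto
    have "monotone_pmap \<alpha>" using L by (simp add: IZ_def)
    then have "the (\<alpha> x) \<le> the (\<alpha> y)"
      using dom that(3) unfolding monotone_pmap_def by simp
    then have "u \<le> v" using that by simp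
    moreover have "u \<noteq> v" using L that dom inj_onD[of \<alpha> "dom \<alpha>" x y] by (auto simp: IZ_def)
    ultimately show ?thesis by simp
  qed
  with L show "?M \<and> ?F" by (auto simp: IZ_def)
next
  assume R: "?M \<and> ?F"
  have "inj_on \<alpha> (dom \<alpha>)"
  proof (rule inj_onI)
    fix x y assume "x \<in> dom \<alpha>" "y \<in> dom \<alpha>" "\<alpha> x = \<alpha> y"
    then show "x = y" using R by (metis domD less_irrefl linorder_neqE)
  qed
  moreover have "monotone_pmap \<alpha>"
    unfolding monotone_pmap_def
    using R by (metis domD option.sel order_le_less)
  ultimately show ?L using R by (simp add: IZ_def)
qed

lemma IZ_less: "\<alpha> \<in> carrier IZ \<Longrightarrow> \<alpha> x = Some u \<Longrightarrow> \<alpha> y = Some v \<Longrightarrow> x < y \<Longrightarrow> u < v"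
  by (auto simp: IZ_iff)

lemma IZ_inj: "\<alpha> \<in> carrier IZ \<Longrightarrow> \<alpha> x = Some u \<Longrightarrow> \<alpha> y = Some u \<Longrightarrow> x = y"
  by (metis IZ_less less_irrefl linorder_neqE)

lemma mult_IZ [simp]: "\<alpha> \<otimes>\<^bsub>IZ\<^esub> \<beta> = \<beta> \<circ>\<^sub>m \<alpha>"
  by (simp add: IZ_def)

lemma map_comp_closed [simp]: "\<alpha> \<in> carrier IZ \<Longrightarrow> \<beta> \<in> carrier IZ \<Longrightarrow> \<beta> \<circ>\<^sub>m \<alpha> \<in> carrier IZ"
  using IZ_mult_closed by simp

lemma map_comp_assoc: "(\<gamma> \<circ>\<^sub>m \<beta>) \<circ>\<^sub>m \<alpha> = \<gamma> \<circ>\<^sub>m (\<beta> \<circ>\<^sub>m \<alpha>)"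
  by (auto simp: map_comp_def split: option.splits)

lemma dom_map_comp_eq: "ran \<alpha> \<subseteq> dom \<beta> \<Longrightarrow> dom (\<beta> \<circ>\<^sub>m \<alpha>) = dom \<alpha>"
  by (force simp: map_comp_Some_iff ran_def dom_def)

lemma ran_map_comp_eq: "dom \<beta> \<subseteq> ran \<alpha> \<Longrightarrow> ran (\<beta> \<circ>\<^sub>m \<alpha>) = ran \<beta>"
  by (force simp: map_comp_Some_iff ran_def dom_def)

lemma restrict_comp_left: "\<alpha> \<circ>\<^sub>m (Some |` A) = \<alpha> |` A"
  by (auto simp: map_comp_def restrict_map_def)

lemma restrict_comp_right: "ran \<alpha> \<subseteq> A \<Longrightarrow> (Some |` A) \<circ>\<^sub>m \<alpha> = \<alpha>"
  by (rule ext) (auto simp: map_comp_def restrict_map_def ran_def split: option.splits)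

section \<open>Partial inverses\<close>

definition pmap_inv :: "('a \<rightharpoonup> 'b) \<Rightarrow> ('b \<rightharpoonup> 'a)" where
  "pmap_inv \<alpha> y = (if y \<in> ran \<alpha> then Some (SOME x. \<alpha> x = Some y) else None)"

text \<open>Injectivity leaves the \<open>SOME\<close> in \<open>pmap_inv\<close> no choice.\<close>

lemma pmap_inv_Some_iff:
  assumes "\<alpha> \<in> carrier IZ"
  shows "pmap_inv \<alpha> y = Some x \<longleftrightarrow> \<alpha> x = Some y"
proof -
  have "(SOME x. \<alpha> x = Some y) = x" if "\<alpha> x = Some y" for x
    using that IZ_inj[OF assms] by blast
  then show ?thesis by (auto simp: pmap_inv_def ran_def)
qed

lemma dom_pmap_inv: "\<alpha> \<in> carrier IZ \<Longrightarrow> dom (pmap_inv \<alpha>) = ran \<alpha>"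
  by (auto simp: dom_def ran_def pmap_inv_Some_iff)

lemma ran_pmap_inv: "\<alpha> \<in> carrier IZ \<Longrightarrow> ran (pmap_inv \<alpha>) = dom \<alpha>"
  by (auto simp: dom_def ran_def pmap_inv_Some_iff)

text \<open>The order is total, so reversing a strictly increasing graph gives a strictly increasing
  one, and the two cofiniteness conditions change places.\<close>

lemma pmap_inv_closed [simp]:
  assumes "\<alpha> \<in> carrier IZ"
  shows "pmap_inv \<alpha> \<in> carrier IZ"
proof -
  have "u < v" if "\<alpha> u = Some x" "\<alpha> v = Some y" "x < y" for x y u v
    using that IZ_less[OF assms that(2,1)] by (metis less_asym linorder_neqE option.inject)
  then show ?thesis
    using assms unfolding IZ_iff[of "pmap_inv \<alpha>"]
    by (auto simp: dom_pmap_inv ran_pmap_inv pmap_inv_Some_iff) (auto simp: IZ_iff)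
qed

lemma pmap_inv_comp:
  assumes "\<alpha> \<in> carrier IZ"
  shows "pmap_inv \<alpha> \<circ>\<^sub>m \<alpha> = Some |` dom \<alpha>"
proof
  fix x
  show "(pmap_inv \<alpha> \<circ>\<^sub>m \<alpha>) x = (Some |` dom \<alpha>) x"
    using pmap_inv_Some_iff[OF assms] by (cases "\<alpha> x") (auto simp: map_comp_def restrict_map_def)
qed

lemma comp_pmap_inv:
  assumes "\<alpha> \<in> carrier IZ"
  shows "\<alpha> \<circ>\<^sub>m pmap_inv \<alpha> = Some |` ran \<alpha>"
proof
  fix y
  show "(\<alpha> \<circ>\<^sub>m pmap_inv \<alpha>) y = (Some |` ran \<alpha>) y"
  proof (cases "y \<in> ran \<alpha>")
    case True
    then obtain x where "\<alpha> x = Some y" by (auto simp: ran_def)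
    then show ?thesis using True pmap_inv_Some_iff[OF assms, of y x]
      by (simp add: map_comp_def restrict_map_def)
  qed (simp add: pmap_inv_def map_comp_def restrict_map_def)
qed

section \<open>Elements with prescribed domain and range\<close>

definition shift :: "int \<Rightarrow> int \<rightharpoonup> int" where
  "shift k x = Some (x + k)"

lemma dom_shift [simp]: "dom (shift k) = UNIV"
  by (auto simp: shift_def dom_def)

lemma ran_shift [simp]: "ran (shift k) = UNIV"
proof -
  have "shift k (y - k) = Some y" for y by (simp add: shift_def)
  then show ?thesis by (blast intro: ranI)
qed

lemma shift_closed [simp]: "shift k \<in> carrier IZ"
  unfolding IZ_iff by (simp add: shift_def)

text \<open>This is the order isomorphism from the integers without c onto all integers that fixes
  everything below c.\<close>

definition close_gap :: "int \<Rightarrow> int \<rightharpoonup> int" where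
  "close_gap c x = (if x < c then Some x else if x = c then None else Some (x - 1))"

lemma dom_close_gap: "dom (close_gap c) = UNIV - {c}"
  by (auto simp: close_gap_def dom_def)

lemma ran_close_gap: "ran (close_gap c) = UNIV"
proof -
  have "close_gap c (if y < c then y else y + 1) = Some y" for y
    by (auto simp: close_gap_def)
  then show ?thesis by (blast intro: ranI)
qed

lemma close_gap_closed: "close_gap c \<in> carrier IZ"
  unfolding IZ_iff dom_close_gap ran_close_gap
  by (auto simp: close_gap_def double_diff split: if_splits)

text \<open>Induction on the set of excluded points: each new one costs one further
  \<open>close_gap\<close>.\<close>

lemma ex_IZ_onto_UNIV:
  assumes "finite F"
  shows "\<exists>\<alpha>\<in>carrier IZ. dom \<alpha> = UNIV - F \<and> ran \<alpha> = UNIV"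
  using assms
proof (induction F)
  case empty
  show ?case by (rule bexI[of _ "shift 0"]) auto
next
  case (insert x F)
  then obtain \<alpha> where \<alpha>: "\<alpha> \<in> carrier IZ" "dom \<alpha> = UNIV - F" "ran \<alpha> = UNIV" by blast
  \<comment> \<open>Removing x from the domain of \<alpha> opens exactly one hole in the range, at
    the image c of x; \<open>close_gap c\<close> removes x from the domain and fills this
    hole.\<close>
  then obtain c where c: "\<alpha> x = Some c" using insert.hyps by blast
  let ?\<beta> = "close_gap c \<circ>\<^sub>m \<alpha>"
  have "y \<in> dom ?\<beta> \<longleftrightarrow> y \<in> UNIV - insert x F" for y
  proof -
    have "y \<in> dom ?\<beta> \<longleftrightarrow> (\<exists>d. \<alpha> y = Some d \<and> d \<noteq> c)"
      by (cases "\<alpha> y") (auto simp: map_comp_def close_gap_def domIff)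
    also have "\<dots> \<longleftrightarrow> y \<in> dom \<alpha> \<and> y \<noteq> x"
      using c IZ_inj[OF \<alpha>(1)] by auto
    finally show ?thesis using \<alpha>(2) by auto
  qed
  then have "dom ?\<beta> = UNIV - insert x F" by blast
  moreover have "ran ?\<beta> = UNIV"
    using \<alpha>(3) by (simp add: ran_map_comp_eq ran_close_gap)
  ultimately show ?case using \<alpha>(1) close_gap_closed by (intro bexI[of _ ?\<beta>]) auto
qed

text \<open>Map A onto all integers, translate by k, and return to B along the inverse of a map from
  B onto all integers. Distinct translations give distinct maps.\<close>

lemma infinite_IZ_dom_ran:
  assumes "finite (UNIV - A)" and "finite (UNIV - B)"
  shows "infinite {\<alpha> \<in> carrier IZ. dom \<alpha> = A \<and> ran \<alpha> = B}"
proof -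
  obtain \<alpha> where \<alpha>: "\<alpha> \<in> carrier IZ" "dom \<alpha> = A" "ran \<alpha> = UNIV"
    using ex_IZ_onto_UNIV[OF assms(1)] by auto
  obtain \<beta> where \<beta>: "\<beta> \<in> carrier IZ" "dom \<beta> = B" "ran \<beta> = UNIV"
    using ex_IZ_onto_UNIV[OF assms(2)] by auto
  define \<gamma> where "\<gamma> k = pmap_inv \<beta> \<circ>\<^sub>m (shift k \<circ>\<^sub>m \<alpha>)" for k
  have ran_shift_\<alpha>: "ran (shift k \<circ>\<^sub>m \<alpha>) = UNIV" for k
    using \<alpha> by (simp add: ran_map_comp_eq)
  have "\<gamma> k \<in> carrier IZ \<and> dom (\<gamma> k) = A \<and> ran (\<gamma> k) = B" for k
    unfolding \<gamma>_def using \<alpha> \<beta> ran_shift_\<alpha>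
    by (simp add: dom_map_comp_eq ran_map_comp_eq dom_pmap_inv ran_pmap_inv)
  then have "range \<gamma> \<subseteq> {\<alpha> \<in> carrier IZ. dom \<alpha> = A \<and> ran \<alpha> = B}" by blast
  moreover have "inj \<gamma>"
  proof (rule injI)
    fix k l assume "\<gamma> k = \<gamma> l"
    \<comment> \<open>Applying \<beta> afterwards cancels \<open>pmap_inv \<beta>\<close>, because
      \<beta> has full range. The two translates of \<alpha> that remain are compared at a single
      point of the domain.\<close>
    then have "\<beta> \<circ>\<^sub>m \<gamma> k = \<beta> \<circ>\<^sub>m \<gamma> l" by simp
    then have eq: "shift k \<circ>\<^sub>m \<alpha> = shift l \<circ>\<^sub>m \<alpha>"
      unfolding \<gamma>_def map_comp_assoc[symmetric] comp_pmap_inv[OF \<beta>(1)]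
      using \<beta> by (simp add: map_comp_assoc restrict_comp_right)
    obtain x y where "\<alpha> x = Some y" using \<alpha>(3) by (force simp: ran_def)
    then show "k = l" using fun_cong[OF eq, of x] by (simp add: map_comp_def shift_def)
  qed
  then have "infinite (range \<gamma>)" using finite_imageD infinite_UNIV_int by blast
  ultimately show ?thesis using finite_subset by blast
qed

section \<open>Idempotents\<close>

lemma idempotents_iff_fixed:
  assumes "\<alpha> \<in> carrier IZ"
  shows "\<alpha> \<in> idempotents IZ \<longleftrightarrow> (\<forall>x\<in>dom \<alpha>. \<alpha> x = Some x)"
proof
  assume "\<alpha> \<in> idempotents IZ"
  then have eq: "\<alpha> \<circ>\<^sub>m \<alpha> = \<alpha>" by (simp add: idempotents_def)
  show "\<forall>x\<in>dom \<alpha>. \<alpha> x = Some x"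
  proof
    fix x assume "x \<in> dom \<alpha>"
    then obtain y where y: "\<alpha> x = Some y" by blast
    \<comment> \<open>Both x and y are sent to y, so injectivity identifies them.\<close>
    then have "\<alpha> y = Some y" using fun_cong[OF eq, of x] by (simp add: map_comp_def)
    then show "\<alpha> x = Some x" using y IZ_inj[OF assms] by blast
  qed
next
  assume "\<forall>x\<in>dom \<alpha>. \<alpha> x = Some x"
  then have "(\<alpha> \<circ>\<^sub>m \<alpha>) x = \<alpha> x" for x
    by (cases "\<alpha> x") (auto simp: map_comp_def dom_def)
  then show "\<alpha> \<in> idempotents IZ" using assms by (auto simp: idempotents_def)
qed

lemma ran_restrict_Some: "ran (Some |` A) = A"
  by (auto simp: ran_def restrict_map_def)

lemma dom_restrict_Some: "dom (Some |` A) = A"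
  by (auto simp: restrict_map_def split: if_splits)

lemma restrict_Some_closed: "Some |` A \<in> carrier IZ \<longleftrightarrow> finite (UNIV - A)"
  unfolding IZ_iff ran_restrict_Some dom_restrict_Some
  by (auto simp: restrict_map_def split: if_splits)

text \<open>This reduces calculations with idempotents to calculations with cofinite sets, where the
  product becomes intersection.\<close>

lemma idempotents_IZ: "idempotents IZ = (\<lambda>A. Some |` A) ` {A. finite (UNIV - A)}"
proof (intro equalityI subsetI)
  fix \<alpha> assume \<alpha>: "\<alpha> \<in> idempotents IZ"
  then have car: "\<alpha> \<in> carrier IZ" by (simp add: idempotents_def)
  have "\<alpha> x = (Some |` dom \<alpha>) x" for x
    using \<alpha> idempotents_iff_fixed[OF car] by (cases "x \<in> dom \<alpha>") (auto simp: restrict_map_def)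
  then have "\<alpha> = Some |` dom \<alpha>" by blast
  moreover have "finite (UNIV - dom \<alpha>)" using car IZ_iff by blast
  ultimately show "\<alpha> \<in> (\<lambda>A. Some |` A) ` {A. finite (UNIV - A)}" by blast
next
  fix \<alpha> :: "int \<rightharpoonup> int" assume "\<alpha> \<in> (\<lambda>A. Some |` A) ` {A. finite (UNIV - A)}"
  then obtain A where A: "finite (UNIV - A)" "\<alpha> = Some |` A" by blast
  then have "\<alpha> \<in> carrier IZ" by (simp add: restrict_Some_closed)
  then show "\<alpha> \<in> idempotents IZ"
    by (subst idempotents_iff_fixed) (auto simp: A)
qed

lemma idempotentE:
  assumes "\<epsilon> \<in> idempotents IZ"
  obtains A where "finite (UNIV - A)" "\<epsilon> = Some |` A"
  using assms by (auto simp: idempotents_IZ)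

lemma restrict_Some_comp: "(Some |` B) \<circ>\<^sub>m (Some |` A) = Some |` (A \<inter> B)"
  by (simp add: restrict_comp_left Int_commute)

lemma restrict_Some_eq_iff: "Some |` A = Some |` B \<longleftrightarrow> A = B"
  using ran_restrict_Some by metis

lemma nat_le_iff_dom:
  assumes "\<epsilon> \<in> idempotents IZ" and "\<iota> \<in> idempotents IZ"
  shows "nat_le IZ \<epsilon> \<iota> \<longleftrightarrow> dom \<epsilon> \<subseteq> dom \<iota>"
  using assms
  by (elim idempotentE) (auto simp: nat_le_def restrict_Some_comp restrict_Some_eq_iff)

section \<open>The semilattice of idempotents and its maximal chains\<close>

lemma semilattice_idempotent_part: "semilattice_struct (idempotent_part IZ)"
  unfolding semilattice_struct_def idempotent_part_def
proof (simp, intro conjI ballI)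
  fix x y assume "x \<in> idempotents IZ" "y \<in> idempotents IZ"
  then obtain A B where AB: "finite (UNIV - A)" "x = Some |` A" "finite (UNIV - B)" "y = Some |` B"
    by (elim idempotentE)
  have "finite (UNIV - A \<inter> B)" using AB by (simp add: Diff_Int)
  then show "y \<circ>\<^sub>m x \<in> idempotents IZ"
    by (auto simp: AB restrict_Some_comp idempotents_IZ)
  show "y \<circ>\<^sub>m x = x \<circ>\<^sub>m y" by (simp add: AB restrict_Some_comp Int_commute)
qed (auto simp: map_comp_assoc elim!: idempotentE simp: restrict_Some_comp)

lemma semilattice_finite_subsets_union: "semilattice_struct finite_subsets_union"
  by (auto simp: semilattice_struct_def finite_subsets_union_def)

lemma compl_dom_bij: "bij_betw (\<lambda>\<epsilon>. UNIV - dom \<epsilon>) (idempotents IZ) {A. finite A}"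
  unfolding bij_betw_def
proof
  show "inj_on (\<lambda>\<epsilon>. UNIV - dom \<epsilon>) (idempotents IZ)"
  proof (rule inj_onI)
    fix \<epsilon> \<phi> :: "int \<rightharpoonup> int"
    assume "\<epsilon> \<in> idempotents IZ" "\<phi> \<in> idempotents IZ" and eq: "UNIV - dom \<epsilon> = UNIV - dom \<phi>"
    then obtain A B where AB: "\<epsilon> = Some |` A" "\<phi> = Some |` B" by (elim idempotentE)
    have "A = B" using eq unfolding AB dom_restrict_Some by blast
    then show "\<epsilon> = \<phi>" by (simp add: AB)
  qed
  have "A \<in> (\<lambda>\<epsilon>. UNIV - dom \<epsilon>) ` idempotents IZ" if "finite A" for A
  proof (rule image_eqI[where x = "Some |` (UNIV - A)"])
    show "A = UNIV - dom (Some |` (UNIV - A) :: int \<rightharpoonup> int)"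
      unfolding dom_restrict_Some by blast
    show "Some |` (UNIV - A) \<in> idempotents IZ"
      unfolding idempotents_IZ using that by (intro imageI) (simp add: double_diff)
  qed
  moreover have "finite (UNIV - dom \<epsilon>)" if "\<epsilon> \<in> idempotents IZ" for \<epsilon>
    using that by (elim idempotentE) (simp only: dom_restrict_Some)
  ultimately show "(\<lambda>\<epsilon>. UNIV - dom \<epsilon>) ` idempotents IZ = {A. finite A}"
    by blast
qed

text \<open>The product of idempotents intersects their domains, and De Morgan's law turns this into
  the union of the complements.\<close>

lemma compl_dom_iso: "(\<lambda>\<epsilon>. UNIV - dom \<epsilon>) \<in> iso (idempotent_part IZ) finite_subsets_union"
proof -
  have "UNIV - dom (\<phi> \<circ>\<^sub>m \<epsilon>) = (UNIV - dom \<epsilon>) \<union> (UNIV - dom \<phi>)"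
    if "\<epsilon> \<in> idempotents IZ" "\<phi> \<in> idempotents IZ" for \<epsilon> \<phi>
    using that by (elim idempotentE) (auto simp: restrict_Some_comp)
  moreover have "(\<lambda>\<epsilon>. UNIV - dom \<epsilon>) \<in> idempotents IZ \<rightarrow> {A. finite A}"
    using compl_dom_bij bij_betw_imp_funcset by blast
  ultimately show ?thesis
    using compl_dom_bij
    by (simp add: iso_def hom_def idempotent_part_def finite_subsets_union_def)
qed

text \<open>Taking complements of domains reverses the order and carries C to a maximal chain of
  finite sets, on which cardinality is a bijection onto the naturals. Negating the cardinality
  restores the direction of the order.\<close>

lemma maximal_idempotent_chain_omega:
  assumes "maximal_idempotent_chain IZ C"
  shows "omega_idempotent_chain IZ C"
proof -
  let ?h = "\<lambda>\<epsilon> :: int \<rightharpoonup> int. UNIV - dom \<epsilon>"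
  have chain: "idempotent_chain IZ C"
    and maxim: "\<And>D. idempotent_chain IZ D \<Longrightarrow> C \<subseteq> D \<Longrightarrow> D = C"
    using assms unfolding maximal_idempotent_chain_def idempotent_chain_def pred_on.maxchain_def
    by blast+
  have chain_iff: "idempotent_chain IZ D \<longleftrightarrow>
      D \<subseteq> idempotents IZ \<and> (\<forall>\<epsilon>\<in>D. \<forall>\<iota>\<in>D. ?h \<epsilon> \<subseteq> ?h \<iota> \<or> ?h \<iota> \<subseteq> ?h \<epsilon>)" for D
  proof (cases "D \<subseteq> idempotents IZ")
    case True
    \<comment> \<open>Chains in \<open>pred_on\<close> are defined with the reflexive closure of the
      relation. On idempotents \<open>nat_le\<close> is already reflexive, so the closure adds
      nothing.\<close>
    have nat_le_iff: "(nat_le IZ)\<^sup>=\<^sup>= \<epsilon> \<iota> \<longleftrightarrow> ?h \<iota> \<subseteq> ?h \<epsilon>" if "\<epsilon> \<in> D" "\<iota> \<in> D" for \<epsilon> \<iota>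
      using that True nat_le_iff_dom[of \<epsilon> \<iota>] by blast
    have "(\<forall>\<epsilon>\<in>D. \<forall>\<iota>\<in>D. (nat_le IZ)\<^sup>=\<^sup>= \<epsilon> \<iota> \<or> (nat_le IZ)\<^sup>=\<^sup>= \<iota> \<epsilon>) \<longleftrightarrow>
        (\<forall>\<epsilon>\<in>D. \<forall>\<iota>\<in>D. ?h \<epsilon> \<subseteq> ?h \<iota> \<or> ?h \<iota> \<subseteq> ?h \<epsilon>)"
      by (intro ball_cong refl) (simp only: nat_le_iff, blast)
    then show ?thesis
      using True by (simp add: idempotent_chain_def pred_on.chain_def del: sup_apply)
  qed (simp add: idempotent_chain_def pred_on.chain_def)
  have sub: "C \<subseteq> idempotents IZ"
    and comparable: "\<And>\<epsilon> \<iota>. \<epsilon> \<in> C \<Longrightarrow> \<iota> \<in> C \<Longrightarrow> ?h \<epsilon> \<subseteq> ?h \<iota> \<or> ?h \<iota> \<subseteq> ?h \<epsilon>"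
    using chain unfolding chain_iff by simp_all
  have inj: "inj_on ?h C" using compl_dom_bij sub by (meson bij_betw_def inj_on_subset)
  have fin: "finite (?h \<epsilon>)" if "\<epsilon> \<in> C" for \<epsilon>
    using that sub by (auto simp: idempotents_def IZ_iff)
  have "bij_betw card (?h ` C) UNIV"
  proof (rule card_bij_betw_maximal_chain)
    fix X :: "int set"
    assume X: "finite X" "\<And>Y. Y \<in> ?h ` C \<Longrightarrow> X \<subseteq> Y \<or> Y \<subseteq> X"
    \<comment> \<open>A finite set comparable with the whole image chain is the complement of the
      domain of some idempotent. Adjoining that idempotent to C gives a chain again, so maximality
      forces it to lie in C.\<close>
    then obtain \<epsilon> where \<epsilon>: "\<epsilon> \<in> idempotents IZ" "?h \<epsilon> = X"
      using compl_dom_bij by (metis (no_types, lifting) bij_betw_def imageE mem_Collect_eq)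
    have "?h \<epsilon> \<subseteq> ?h \<iota> \<or> ?h \<iota> \<subseteq> ?h \<epsilon>" if "\<iota> \<in> C" for \<iota>
      unfolding \<epsilon>(2) by (rule X(2)) (use that in blast)
    then have "idempotent_chain IZ (insert \<epsilon> C)"
      using sub \<epsilon>(1) comparable unfolding chain_iff ball_simps insert_subset
      by (simp add: disj_commute)
    then have "insert \<epsilon> C = C" by (rule maxim) blast
    then have "\<epsilon> \<in> C" by blast
    then show "X \<in> ?h ` C" using \<epsilon>(2) by blast
  next
    show "X \<subseteq> Y \<or> Y \<subseteq> X" if "X \<in> ?h ` C" "Y \<in> ?h ` C" for X Y
      using that comparable by (elim imageE) simp
  qed (use fin infinite_UNIV_int in auto)
  then have bij: "bij_betw (\<lambda>\<epsilon>. card (?h \<epsilon>)) C UNIV"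
    using bij_betw_trans[OF inj_on_imp_bij_betw[OF inj]] by (simp add: comp_def)
  have "bij_betw (\<lambda>n. - int n) UNIV {..0}"
    by (rule bij_betw_byWitness[of _ "\<lambda>k. nat (- k)"]) auto
  from bij_betw_trans[OF bij this] have "bij_betw (\<lambda>\<epsilon>. - int (card (?h \<epsilon>))) C {..0}"
    by (simp add: comp_def)
  moreover have "nat_le IZ \<epsilon> \<iota> \<longleftrightarrow> - int (card (?h \<epsilon>)) \<le> - int (card (?h \<iota>))"
    if "\<epsilon> \<in> C" "\<iota> \<in> C" for \<epsilon> \<iota>
  proof -
    have "nat_le IZ \<epsilon> \<iota> \<longleftrightarrow> ?h \<iota> \<subseteq> ?h \<epsilon>"
      using nat_le_iff_dom[of \<epsilon> \<iota>] that sub by auto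
    \<comment> \<open>For comparable finite sets, inclusion is decided by cardinality.\<close>
    also have "\<dots> \<longleftrightarrow> card (?h \<iota>) \<le> card (?h \<epsilon>)"
    proof
      assume "card (?h \<iota>) \<le> card (?h \<epsilon>)"
      moreover have "?h \<epsilon> \<subseteq> ?h \<iota> \<or> ?h \<iota> \<subseteq> ?h \<epsilon>" using comparable that by simp
      ultimately show "?h \<iota> \<subseteq> ?h \<epsilon>" using card_seteq[OF fin[OF that(2)]] by blast
    qed (rule card_mono[OF fin[OF that(1)]])
    finally show ?thesis by simp
  qed
  ultimately show ?thesis
    unfolding omega_idempotent_chain_def using chain by blast
qed

section \<open>Green's relations\<close>

text \<open>The product of \<alpha> with its inverse is the identity on dom \<alpha>. Multiplying it
  by a \<beta> whose domain lies in dom \<alpha> returns \<beta>, so \<beta> is \<alpha> times the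
  product of the inverse of \<alpha> with \<beta>.\<close>

lemma right_principal_IZ:
  assumes "\<alpha> \<in> carrier IZ"
  shows "right_principal IZ \<alpha> = {\<beta> \<in> carrier IZ. dom \<beta> \<subseteq> dom \<alpha>}"
proof (intro equalityI subsetI)
  fix \<beta> assume "\<beta> \<in> {\<beta> \<in> carrier IZ. dom \<beta> \<subseteq> dom \<alpha>}"
  then have \<beta>: "\<beta> \<in> carrier IZ" "dom \<beta> \<subseteq> dom \<alpha>" by auto
  have "(\<beta> |` dom \<alpha>) x = \<beta> x" for x
    using \<beta>(2) by (cases "\<beta> x") (auto simp: restrict_map_def)
  then have "\<beta> |` dom \<alpha> = \<beta>" by blast
  then have "\<beta> = \<alpha> \<otimes>\<^bsub>IZ\<^esub> (\<beta> \<circ>\<^sub>m pmap_inv \<alpha>)"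
    by (simp add: map_comp_assoc pmap_inv_comp[OF assms] restrict_comp_left)
  moreover have "\<beta> \<circ>\<^sub>m pmap_inv \<alpha> \<in> carrier IZ" using assms \<beta> by simp
  ultimately show "\<beta> \<in> right_principal IZ \<alpha>" unfolding right_principal_def by blast
qed (use assms in \<open>auto simp: right_principal_def map_comp_Some_iff\<close>)

text \<open>Dually, the inverse of \<alpha> times \<alpha> is the identity on ran \<alpha>, and
  multiplying by it on the right fixes every \<beta> whose range lies in ran \<alpha>.\<close>

lemma left_principal_IZ:
  assumes "\<alpha> \<in> carrier IZ"
  shows "left_principal IZ \<alpha> = {\<beta> \<in> carrier IZ. ran \<beta> \<subseteq> ran \<alpha>}"
proof (intro equalityI subsetI)
  fix \<beta> assume "\<beta> \<in> {\<beta> \<in> carrier IZ. ran \<beta> \<subseteq> ran \<alpha>}"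
  then have \<beta>: "\<beta> \<in> carrier IZ" "ran \<beta> \<subseteq> ran \<alpha>" by auto
  have "\<beta> = (pmap_inv \<alpha> \<circ>\<^sub>m \<beta>) \<otimes>\<^bsub>IZ\<^esub> \<alpha>"
    using \<beta>(2) by (simp add: map_comp_assoc[symmetric] comp_pmap_inv[OF assms] restrict_comp_right)
  moreover have "pmap_inv \<alpha> \<circ>\<^sub>m \<beta> \<in> carrier IZ" using assms \<beta> by simp
  ultimately show "\<beta> \<in> left_principal IZ \<alpha>" unfolding left_principal_def by blast
qed (use assms in \<open>auto simp: left_principal_def ran_def map_comp_Some_iff\<close>)

lemma green_R_IZ:
  assumes "\<alpha> \<in> carrier IZ" and "\<beta> \<in> carrier IZ"
  shows "(\<alpha>, \<beta>) \<in> green_R IZ \<longleftrightarrow> dom \<alpha> = dom \<beta>"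
proof -
  have "(\<alpha>, \<beta>) \<in> green_R IZ \<longleftrightarrow> right_principal IZ \<alpha> = right_principal IZ \<beta>"
    using assms by (simp add: green_R_def)
  also have "\<dots> \<longleftrightarrow> dom \<alpha> = dom \<beta>"
  proof
    assume "right_principal IZ \<alpha> = right_principal IZ \<beta>"
    \<comment> \<open>Each element lies in its own principal ideal, so equality of the ideals yields
      both inclusions of domains.\<close>
    then have "\<alpha> \<in> right_principal IZ \<beta>" "\<beta> \<in> right_principal IZ \<alpha>"
      by (auto simp: right_principal_def)
    then show "dom \<alpha> = dom \<beta>"
      using assms by (simp add: right_principal_IZ)
  qed (use assms in \<open>simp add: right_principal_IZ\<close>)
  finally show ?thesis .
qed

lemma green_L_IZ:
  assumes "\<alpha> \<in> carrier IZ" and "\<beta> \<in> carrier IZ"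
  shows "(\<alpha>, \<beta>) \<in> green_L IZ \<longleftrightarrow> ran \<alpha> = ran \<beta>"
proof -
  have "(\<alpha>, \<beta>) \<in> green_L IZ \<longleftrightarrow> left_principal IZ \<alpha> = left_principal IZ \<beta>"
    using assms by (simp add: green_L_def)
  also have "\<dots> \<longleftrightarrow> ran \<alpha> = ran \<beta>"
  proof
    assume "left_principal IZ \<alpha> = left_principal IZ \<beta>"
    then have "\<alpha> \<in> left_principal IZ \<beta>" "\<beta> \<in> left_principal IZ \<alpha>"
      by (auto simp: left_principal_def)
    then show "ran \<alpha> = ran \<beta>"
      using assms by (simp add: left_principal_IZ)
  qed (use assms in \<open>simp add: left_principal_IZ\<close>)
  finally show ?thesis .
qed

section \<open>Simplicity and factorizations of idempotents\<close>

text \<open>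
  Choosing \<open>\<sigma>\<close> from the domain of \<open>\<beta>\<close> onto the domain of \<open>\<alpha>\<close> makes \<open>\<sigma>\<alpha>\<close> and \<open>\<beta>\<close> related by \<open>\<R>\<close>.
\<close>

lemma IZ_factor_through:
  assumes \<alpha>: "\<alpha> \<in> carrier IZ" and \<beta>: "\<beta> \<in> carrier IZ"
  obtains \<sigma> \<tau> where "\<sigma> \<in> carrier IZ" "\<tau> \<in> carrier IZ" "\<beta> = \<sigma> \<otimes>\<^bsub>IZ\<^esub> \<alpha> \<otimes>\<^bsub>IZ\<^esub> \<tau>"
proof -
  have "finite (UNIV - dom \<beta>)" "finite (UNIV - dom \<alpha>)" using \<alpha> \<beta> by (simp_all add: IZ_iff)
  then have "{\<sigma> \<in> carrier IZ. dom \<sigma> = dom \<beta> \<and> ran \<sigma> = dom \<alpha>} \<noteq> {}"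
    by (intro infinite_imp_nonempty infinite_IZ_dom_ran)
  then obtain \<sigma> where \<sigma>: "\<sigma> \<in> carrier IZ" "dom \<sigma> = dom \<beta>" "ran \<sigma> = dom \<alpha>"
    by blast
  have "dom (\<alpha> \<circ>\<^sub>m \<sigma>) = dom \<beta>" using \<sigma> by (simp add: dom_map_comp_eq)
  then have "\<beta> \<in> right_principal IZ (\<sigma> \<otimes>\<^bsub>IZ\<^esub> \<alpha>)"
    using \<alpha> \<beta> \<sigma> by (simp add: right_principal_IZ)
  \<comment> \<open>The first case comes from the identity adjoined in the definition of the
    principal ideal; there the identity of \<open>IZ\<close> serves as \<tau>.\<close>
  then consider "\<beta> = \<sigma> \<otimes>\<^bsub>IZ\<^esub> \<alpha>"
    | \<tau> where "\<tau> \<in> carrier IZ" "\<beta> = \<sigma> \<otimes>\<^bsub>IZ\<^esub> \<alpha> \<otimes>\<^bsub>IZ\<^esub> \<tau>"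
    unfolding right_principal_def by blast
  then show ?thesis
    by cases (use that \<sigma>(1) monoid.one_closed[OF monoid_IZ] monoid.r_one[OF monoid_IZ] \<alpha>
        IZ_mult_closed in metis)+
qed

text \<open>An ideal contains some \<alpha>, hence every product with \<alpha> as a middle factor,
  and by \<open>IZ_factor_through\<close> every element is such a product.\<close>

lemma simple_IZ: "simple_semigroup IZ"
  unfolding simple_semigroup_def
proof
  assume "\<exists>I. two_sided_ideal IZ I \<and> I \<noteq> carrier IZ"
  then obtain I where I: "two_sided_ideal IZ I" "I \<noteq> carrier IZ" by blast
  then obtain \<alpha> where \<alpha>: "\<alpha> \<in> I" "\<alpha> \<in> carrier IZ" unfolding two_sided_ideal_def by blast
  have "\<beta> \<in> I" if \<beta>: "\<beta> \<in> carrier IZ" for \<beta>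
  proof -
    obtain \<sigma> \<tau> where "\<sigma> \<in> carrier IZ" "\<tau> \<in> carrier IZ" "\<beta> = \<sigma> \<otimes>\<^bsub>IZ\<^esub> \<alpha> \<otimes>\<^bsub>IZ\<^esub> \<tau>"
      using IZ_factor_through[OF \<alpha>(2) \<beta>] .
    then show ?thesis using I(1) \<alpha>(1) unfolding two_sided_ideal_def by blast
  qed
  then show False using I unfolding two_sided_ideal_def by blast
qed

lemma two_sided_principal_IZ:
  assumes "\<alpha> \<in> carrier IZ"
  shows "two_sided_principal IZ \<alpha> = carrier IZ"
proof (intro equalityI subsetI)
  fix \<beta> assume "\<beta> \<in> carrier IZ"
  then show "\<beta> \<in> two_sided_principal IZ \<alpha>"
    using IZ_factor_through[OF assms] unfolding two_sided_principal_def by blast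
qed (use assms in \<open>auto simp: two_sided_principal_def\<close>)

lemma green_J_IZ: "green_J IZ = carrier IZ \<times> carrier IZ"
  by (auto simp: green_J_def two_sided_principal_IZ)

text \<open>If \<epsilon> and \<phi> are the identities on A and B, any \<alpha> from A onto B
  together with its inverse gives the two required products, and there are infinitely many such
  \<alpha>.\<close>

lemma infinite_idempotent_factorizations:
  assumes "\<epsilon> \<in> idempotents IZ" and "\<phi> \<in> idempotents IZ"
  shows "infinite {\<alpha>\<in>carrier IZ. \<exists>\<beta>\<in>carrier IZ. \<alpha> \<otimes>\<^bsub>IZ\<^esub> \<beta> = \<epsilon> \<and> \<beta> \<otimes>\<^bsub>IZ\<^esub> \<alpha> = \<phi>}"
proof -
  obtain A B where A: "finite (UNIV - A)" "\<epsilon> = Some |` A" and B: "finite (UNIV - B)" "\<phi> = Some |` B"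
    using assms by (elim idempotentE)
  have "{\<alpha> \<in> carrier IZ. dom \<alpha> = A \<and> ran \<alpha> = B} \<subseteq>
      {\<alpha>\<in>carrier IZ. \<exists>\<beta>\<in>carrier IZ. \<alpha> \<otimes>\<^bsub>IZ\<^esub> \<beta> = \<epsilon> \<and> \<beta> \<otimes>\<^bsub>IZ\<^esub> \<alpha> = \<phi>}" (is "_ \<subseteq> ?S")
  proof
    fix \<alpha> assume "\<alpha> \<in> {\<alpha> \<in> carrier IZ. dom \<alpha> = A \<and> ran \<alpha> = B}"
    then have "\<alpha> \<in> carrier IZ" "\<alpha> \<otimes>\<^bsub>IZ\<^esub> pmap_inv \<alpha> = \<epsilon>" "pmap_inv \<alpha> \<otimes>\<^bsub>IZ\<^esub> \<alpha> = \<phi>"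
      using A(2) B(2) by (simp_all add: pmap_inv_comp comp_pmap_inv)
    then show "\<alpha> \<in> ?S" using pmap_inv_closed by blast
  qed
  then show ?thesis using infinite_IZ_dom_ran[OF A(1) B(1)] finite_subset by blast
qed

theorem proposition2p1:
  shows "(\<forall>\<alpha>\<in>carrier IZ. \<alpha> \<in> idempotents IZ \<longleftrightarrow> (\<forall>x\<in>dom \<alpha>. \<alpha> x = Some x)) \<and>
    (\<forall>\<epsilon>\<in>idempotents IZ. \<forall>\<iota>\<in>idempotents IZ. nat_le IZ \<epsilon> \<iota> \<longleftrightarrow> dom \<epsilon> \<subseteq> dom \<iota>) \<and>
    (semilattice_struct (idempotent_part IZ) \<and> semilattice_struct finite_subsets_union \<and>
      (\<lambda>\<epsilon>. UNIV - dom \<epsilon>) \<in> iso (idempotent_part IZ) finite_subsets_union) \<and>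
    (\<forall>C. maximal_idempotent_chain IZ C \<longrightarrow> omega_idempotent_chain IZ C) \<and>
    (\<forall>\<alpha>\<in>carrier IZ. \<forall>\<beta>\<in>carrier IZ. (\<alpha>, \<beta>) \<in> green_R IZ \<longleftrightarrow> dom \<alpha> = dom \<beta>) \<and>
    (\<forall>\<alpha>\<in>carrier IZ. \<forall>\<beta>\<in>carrier IZ. (\<alpha>, \<beta>) \<in> green_L IZ \<longleftrightarrow> ran \<alpha> = ran \<beta>) \<and>
    (\<forall>\<alpha>\<in>carrier IZ. \<forall>\<beta>\<in>carrier IZ.
      (\<alpha>, \<beta>) \<in> green_H IZ \<longleftrightarrow> dom \<alpha> = dom \<beta> \<and> ran \<alpha> = ran \<beta>) \<and>
    (simple_semigroup IZ \<and> green_J IZ = carrier IZ \<times> carrier IZ) \<and>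
    (\<forall>\<epsilon>\<in>idempotents IZ. \<forall>\<phi>\<in>idempotents IZ.
      infinite {\<alpha>\<in>carrier IZ. \<exists>\<beta>\<in>carrier IZ. \<alpha> \<otimes>\<^bsub>IZ\<^esub> \<beta> = \<epsilon> \<and> \<beta> \<otimes>\<^bsub>IZ\<^esub> \<alpha> = \<phi>} \<and>
      infinite {\<beta>\<in>carrier IZ. \<exists>\<alpha>\<in>carrier IZ. \<alpha> \<otimes>\<^bsub>IZ\<^esub> \<beta> = \<epsilon> \<and> \<beta> \<otimes>\<^bsub>IZ\<^esub> \<alpha> = \<phi>})"
proof -
  \<comment> \<open>Interchanging \<epsilon> and \<phi> interchanges the roles of the two
    factors.\<close>
  have right_factors:
    "infinite {\<beta>\<in>carrier IZ. \<exists>\<alpha>\<in>carrier IZ. \<alpha> \<otimes>\<^bsub>IZ\<^esub> \<beta> = \<epsilon> \<and> \<beta> \<otimes>\<^bsub>IZ\<^esub> \<alpha> = \<phi>}"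
    if "\<epsilon> \<in> idempotents IZ" "\<phi> \<in> idempotents IZ" for \<epsilon> \<phi>
    using infinite_idempotent_factorizations[OF that(2,1)] by (simp add: conj_commute)
  have green_H_iff: "(\<alpha>, \<beta>) \<in> green_H IZ \<longleftrightarrow> dom \<alpha> = dom \<beta> \<and> ran \<alpha> = ran \<beta>"
    if "\<alpha> \<in> carrier IZ" "\<beta> \<in> carrier IZ" for \<alpha> \<beta>
    using green_R_IZ[OF that] green_L_IZ[OF that] by (auto simp: green_H_def)
  show ?thesis
    by (intro conjI ballI allI impI idempotents_iff_fixed nat_le_iff_dom
        semilattice_idempotent_part semilattice_finite_subsets_union compl_dom_iso
        maximal_idempotent_chain_omega green_R_IZ green_L_IZ green_H_iff simple_IZ green_J_IZ
        infinite_idempotent_factorizations right_factors)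
qed

end
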